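(* Let $(X,\mathcal{B}_X,\mu,T)$ be a $\mathbb{Z}^2$-measure preserving dynamical system. Then the following statements are equivalent. (a) There exist two directions $\vec{v}=(1,\beta_1),\vec{w}=(1,\beta_2)\in\mathbb{R}^2$ with $\beta_1\neq\beta_2$ such that $\mathcal{K}^{\vec{v}}_{\mu}\cap\mathcal{K}^{\vec{w}}_{\mu}=\{X,\emptyset\}$ (modulo $\mu$-null sets). (b) $(X,\mathcal{B}_X,\mu,T)$ is weakly mixing.
   Context: A $\mathbb{Z}^2$-measure preserving dynamical system $(X,\mathcal{B}_X,\mu,T)$ consists of a compact metric space $X$, its Borel $\sigma$-algebra $\mathcal{B}_X$, a group homomorphism $(m,n)\mapsto T^{(m,n)}$ from the additive group $\mathbb{Z}^2$ to the group of homeomorphisms of $X$, and a Borel probability measure $\mu$ invariant under every $T^{(m,n)}$. For $f\in L^2(X,\mathcal{B}_X,\mu)$, $U_T^{(m,n)}f=f\circ T^{(m,n)}$; $1_B$ is the indicator function of $B$. For $\vec{v}=(1,\beta)\in\mathbb{R}^2$ and $b\in(0,\infty)$, $\Lambda^{\vec{v}}(b)=\{(m,n)\in\mathbb{Z}^2:\beta m-b\le n\le\beta m+b\}$. The directional Kronecker algebra $\mathcal{K}_\mu^{\vec{v}}$ is the $\sigma$-algebra of all $B\in\mathcal{B}_X$ such that the closure of $\{U_T^{(m,n)}1_B:(m,n)\in\Lambda^{\vec{v}}(b)\}$ is compact in $L^2(X,\mathcal{B}_X,\mu)$; it does not depend on the choice of $b\in(0,\infty)$. The Kronecker algebra $\mathcal{K}_\mu$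 of the $\mathbb{Z}^2$-action is the $\sigma$-algebra of all $B\in\mathcal{B}_X$ such that the closure of $\{U_T^{(m,n)}1_B:(m,n)\in\mathbb{Z}^2\}$ is compact in $L^2(X,\mathcal{B}_X,\mu)$. The system is weakly mixing if $\mathcal{K}_\mu=\{X,\emptyset\}$ modulo $\mu$-null sets. A $\sigma$-algebra equals $\{X,\emptyset\}$ modulo $\mu$-null sets if each of its members has $\mu$-measure $0$ or $1$. *)

theory Defs
  imports "HOL-Probability.Probability"
begin

section \<open>The metric space \<open>L\<^sup>2\<close>\<close>

definition L2_functions :: "'a measure \<Rightarrow> ('a \<Rightarrow> complex) set" where
  "L2_functions M = {f \<in> borel_measurable M. integrable M (\<lambda>x. (cmod (f x))\<^sup>2)}"

definition L2_rel :: "'a measure \<Rightarrow> (('a \<Rightarrow> complex) \<times> ('a \<Rightarrow> complex)) set" where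
  "L2_rel M = {(f, g). f \<in> L2_functions M \<and> g \<in> L2_functions M \<and> (AE x in M. f x = g x)}"

definition L2_space :: "'a measure \<Rightarrow> ('a \<Rightarrow> complex) set set" where
  "L2_space M = L2_functions M // L2_rel M"

definition L2_class :: "'a measure \<Rightarrow> ('a \<Rightarrow> complex) \<Rightarrow> ('a \<Rightarrow> complex) set" where
  "L2_class M f = L2_rel M `` {f}"

definition L2_dist_fun :: "'a measure \<Rightarrow> ('a \<Rightarrow> complex) \<Rightarrow> ('a \<Rightarrow> complex) \<Rightarrow> real" where
  "L2_dist_fun M f g = sqrt (\<integral>x. (cmod (f x - g x))\<^sup>2 \<partial>M)"

text \<open>The choice of representatives is immaterial, see \<open>L2_dist_class\<close> below.\<close>

definition L2_dist :: "'a measure \<Rightarrow> ('a \<Rightarrow> complex) set \<Rightarrow> ('a \<Rightarrow> complex) set \<Rightarrow> real" where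
  "L2_dist M F G = L2_dist_fun M (SOME f. f \<in> F) (SOME g. g \<in> G)"

definition L2_topology :: "'a measure \<Rightarrow> ('a \<Rightarrow> complex) set topology" where
  "L2_topology M = Metric_space.mtopology (L2_space M) (L2_dist M)"

lemma equiv_L2_rel: "equiv (L2_functions M) (L2_rel M)"
proof (rule equivI)
  show "trans (L2_rel M)"
  proof (rule transI)
    fix f g h assume "(f, g) \<in> L2_rel M" "(g, h) \<in> L2_rel M"
    then have "f \<in> L2_functions M" "h \<in> L2_functions M"
      and "AE x in M. f x = g x" "AE x in M. g x = h x"
      by (auto simp: L2_rel_def)
    moreover from this(3,4) have "AE x in M. f x = h x"
      by eventually_elim simp
    ultimately show "(f, h) \<in> L2_rel M"
      by (simp add: L2_rel_def)
  qed
qed (auto simp: L2_rel_def refl_on_def sym_def eq_commute)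

lemma L2_class_in_space: "f \<in> L2_functions M \<Longrightarrow> L2_class M f \<in> L2_space M"
  by (auto simp: L2_class_def L2_space_def intro: quotientI)

lemma L2_functions_diff:
  assumes "f \<in> L2_functions M" "g \<in> L2_functions M"
  shows "integrable M (\<lambda>x. (cmod (f x - g x))\<^sup>2)"
proof (rule Bochner_Integration.integrable_bound)
  show "integrable M (\<lambda>x. 2 * (cmod (f x))\<^sup>2 + 2 * (cmod (g x))\<^sup>2)"
    using assms by (auto simp: L2_functions_def)
  show "(\<lambda>x. (cmod (f x - g x))\<^sup>2) \<in> borel_measurable M"
    using assms by (auto simp: L2_functions_def)
  have "(cmod (a - b))\<^sup>2 \<le> 2 * (cmod a)\<^sup>2 + 2 * (cmod b)\<^sup>2" for a b :: complex
  proof -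
    have "(cmod (a - b))\<^sup>2 \<le> (cmod a + cmod b)\<^sup>2"
      by (intro power_mono norm_triangle_ineq4) auto
    also have "\<dots> \<le> 2 * (cmod a)\<^sup>2 + 2 * (cmod b)\<^sup>2"
      using zero_le_power2[of "cmod a - cmod b"] by (simp add: power2_eq_square algebra_simps)
    finally show ?thesis .
  qed
  then show "AE x in M. norm ((cmod (f x - g x))\<^sup>2)
      \<le> norm (2 * (cmod (f x))\<^sup>2 + 2 * (cmod (g x))\<^sup>2)"
    by auto
qed

lemma L2_dist_fun_triangle:
  assumes "f \<in> L2_functions M" "g \<in> L2_functions M" "h \<in> L2_functions M"
  shows "L2_dist_fun M f h \<le> L2_dist_fun M f g + L2_dist_fun M g h"
proof (rule field_le_epsilon)
  fix e :: real assume "e > 0"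
  define A B where "A = L2_dist_fun M f g + e / 2" and "B = L2_dist_fun M g h + e / 2"
  have nn: "L2_dist_fun M f g \<ge> 0" "L2_dist_fun M g h \<ge> 0"
    by (auto simp: L2_dist_fun_def)
  have pos: "A > 0" "B > 0" using nn \<open>e > 0\<close> by (auto simp: A_def B_def)
  have sq: "(\<integral>x. (cmod (f x - g x))\<^sup>2 \<partial>M) \<le> A\<^sup>2" "(\<integral>x. (cmod (g x - h x))\<^sup>2 \<partial>M) \<le> B\<^sup>2"
    using nn \<open>e > 0\<close> by (auto simp: A_def B_def L2_dist_fun_def intro!: sqrt_le_D)
  have pw: "(cmod (a - c))\<^sup>2 \<le> (1 + B / A) * (cmod (a - b))\<^sup>2 + (1 + A / B) * (cmod (b - c))\<^sup>2"
    for a b c :: complex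
  proof -
    define u v where "u = cmod (a - b)" and "v = cmod (b - c)"
    have "cmod (a - c) \<le> u + v"
      using norm_triangle_ineq[of "a - b" "b - c"] by (simp add: u_def v_def)
    then have "(cmod (a - c))\<^sup>2 \<le> (u + v)\<^sup>2" by (intro power_mono) auto
    also have "(u + v)\<^sup>2 = (1 + B / A) * u\<^sup>2 + (1 + A / B) * v\<^sup>2 - (B * u - A * v)\<^sup>2 / (A * B)"
      using pos by (simp add: field_simps power2_eq_square)
    also have "\<dots> \<le> (1 + B / A) * u\<^sup>2 + (1 + A / B) * v\<^sup>2"
      using pos by simp
    finally show ?thesis by (simp add: u_def v_def)
  qed
  have "(\<integral>x. (cmod (f x - h x))\<^sup>2 \<partial>M)
      \<le> (\<integral>x. (1 + B / A) * (cmod (f x - g x))\<^sup>2 + (1 + A / B) * (cmod (g x - h x))\<^sup>2 \<partial>M)"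
    using assms pw by (intro integral_mono) (auto intro!: L2_functions_diff)
  also have "\<dots> = (1 + B / A) * (\<integral>x. (cmod (f x - g x))\<^sup>2 \<partial>M)
      + (1 + A / B) * (\<integral>x. (cmod (g x - h x))\<^sup>2 \<partial>M)"
    using L2_functions_diff[of f M g] L2_functions_diff[of g M h] assms by simp
  also have "\<dots> \<le> (1 + B / A) * A\<^sup>2 + (1 + A / B) * B\<^sup>2"
    using sq pos by (intro add_mono mult_left_mono) auto
  also have "\<dots> = (A + B)\<^sup>2"
    using pos by (simp add: field_simps power2_eq_square)
  finally have "L2_dist_fun M f h \<le> A + B"
    using pos unfolding L2_dist_fun_def by (intro real_le_lsqrt) auto
  then show "L2_dist_fun M f h \<le> L2_dist_fun M f g + L2_dist_fun M g h + e"
    by (simp add: A_def B_def)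
qed

lemma L2_dist_fun_eq_0:
  assumes "f \<in> L2_functions M" "g \<in> L2_functions M"
  shows "L2_dist_fun M f g = 0 \<longleftrightarrow> (AE x in M. f x = g x)"
  using integral_nonneg_eq_0_iff_AE[OF L2_functions_diff[OF assms]]
  by (simp add: L2_dist_fun_def)

lemma L2_dist_class:
  assumes "f \<in> L2_functions M" "g \<in> L2_functions M"
  shows "L2_dist M (L2_class M f) (L2_class M g) = L2_dist_fun M f g"
proof -
  define f' g' where "f' = (SOME u. u \<in> L2_class M f)" and "g' = (SOME u. u \<in> L2_class M g)"
  have "f \<in> L2_class M f" "g \<in> L2_class M g"
    using assms by (auto simp: L2_class_def L2_rel_def)
  then have "f' \<in> L2_class M f" "g' \<in> L2_class M g"
    unfolding f'_def g'_def by (simp_all add: some_in_eq) blast+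
  then have "f' \<in> L2_functions M" "g' \<in> L2_functions M"
    and ae: "AE x in M. f x = f' x" "AE x in M. g x = g' x"
    by (auto simp: L2_class_def L2_rel_def)
  then have "(\<integral>x. (cmod (f' x - g' x))\<^sup>2 \<partial>M) = (\<integral>x. (cmod (f x - g x))\<^sup>2 \<partial>M)"
    using assms by (intro integral_cong_AE) (auto simp: L2_functions_def)
  then show ?thesis
    by (simp add: L2_dist_def L2_dist_fun_def f'_def g'_def)
qed

lemma Metric_space_L2: "Metric_space (L2_space M) (L2_dist M)"
proof
  have ex: "\<exists>f\<in>L2_functions M. F = L2_class M f" if "F \<in> L2_space M" for F
    using that by (auto simp: L2_space_def L2_class_def elim!: quotientE)
  show "0 \<le> L2_dist M F G" for F G
    by (simp add: L2_dist_def L2_dist_fun_def)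
  show "L2_dist M F G = L2_dist M G F" for F G
    by (simp add: L2_dist_def L2_dist_fun_def norm_minus_commute)
  show "L2_dist M F G = 0 \<longleftrightarrow> F = G" if FG: "F \<in> L2_space M" "G \<in> L2_space M" for F G
  proof -
    obtain f g where fg: "f \<in> L2_functions M" "F = L2_class M f" "g \<in> L2_functions M" "G = L2_class M g"
      using ex[OF FG(1)] ex[OF FG(2)] by blast
    have "F = G \<longleftrightarrow> (f, g) \<in> L2_rel M"
      unfolding fg(2,4) L2_class_def by (rule eq_equiv_class_iff[OF equiv_L2_rel fg(1,3)])
    then show ?thesis
      using fg by (simp add: L2_dist_class L2_dist_fun_eq_0 L2_rel_def)
  qed
  show "L2_dist M F H \<le> L2_dist M F G + L2_dist M G H"
    if "F \<in> L2_space M" "G \<in> L2_space M" "H \<in> L2_space M" for F G H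
    using ex[OF that(1)] ex[OF that(2)] ex[OF that(3)]
    by (auto simp: L2_dist_class intro: L2_dist_fun_triangle)
qed


section \<open>Measure preserving actions of \<open>\<int>\<^sup>2\<close> on compact metric spaces\<close>

text \<open>The phase space is the whole type. Additivity of \<open>T\<close> only yields that \<open>T 0\<close> is idempotent;
  together with bijectivity it gives \<open>T 0 = id\<close>.\<close>

locale Z2_measure_preserving_system = prob_space M
  for M :: "'a::metric_space measure" +
  fixes T :: "int \<times> int \<Rightarrow> 'a \<Rightarrow> 'a"
  assumes compact_phase_space: "compact (UNIV :: 'a set)"
    and sets_eq_borel: "sets M = sets borel"
    and homeomorphism_T: "\<And>k. \<exists>S. homeomorphism UNIV UNIV (T k) S"
    and T_add: "\<And>k l. T (k + l) = T k \<circ> T l"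
    and invariant: "\<And>k. distr M M (T k) = M"

definition koopman :: "(int \<times> int \<Rightarrow> 'a \<Rightarrow> 'a) \<Rightarrow> int \<times> int \<Rightarrow> ('a \<Rightarrow> complex) \<Rightarrow> 'a \<Rightarrow> complex" where
  "koopman T k f = f \<circ> T k"

definition L2_orbit ::
    "'a measure \<Rightarrow> (int \<times> int \<Rightarrow> 'a \<Rightarrow> 'a) \<Rightarrow> (int \<times> int) set \<Rightarrow> 'a set \<Rightarrow> ('a \<Rightarrow> complex) set set" where
  "L2_orbit M T \<Lambda> B = (\<lambda>k. L2_class M (koopman T k (indicator B))) ` \<Lambda>"

definition compact_orbit_sets ::
    "'a measure \<Rightarrow> (int \<times> int \<Rightarrow> 'a \<Rightarrow> 'a) \<Rightarrow> (int \<times> int) set \<Rightarrow> 'a set set" where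
  "compact_orbit_sets M T \<Lambda> =
    {B \<in> sets M. compactin (L2_topology M) (L2_topology M closure_of L2_orbit M T \<Lambda> B)}"

definition strip :: "real \<Rightarrow> real \<Rightarrow> (int \<times> int) set" where
  "strip \<beta> b = {(m, n). \<beta> * of_int m - b \<le> of_int n \<and> of_int n \<le> \<beta> * of_int m + b}"

text \<open>The algebra for the direction \<open>(1, \<beta>)\<close>; it does not depend on the width \<open>b > 0\<close>.\<close>

definition directional_kronecker_algebra ::
    "'a measure \<Rightarrow> (int \<times> int \<Rightarrow> 'a \<Rightarrow> 'a) \<Rightarrow> real \<Rightarrow> real \<Rightarrow> 'a set set" where
  "directional_kronecker_algebra M T \<beta> b = compact_orbit_sets M T (strip \<beta> b)"

definition kronecker_algebra :: "'a measure \<Rightarrow> (int \<times> int \<Rightarrow> 'a \<Rightarrow> 'a) \<Rightarrow> 'a set set" where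
  "kronecker_algebra M T = compact_orbit_sets M T UNIV"

definition trivial_mod_null :: "'a measure \<Rightarrow> 'a set set \<Rightarrow> bool" where
  "trivial_mod_null M \<A> \<longleftrightarrow> (\<forall>B\<in>\<A>. measure M B = 0 \<or> measure M B = 1)"

definition weakly_mixing :: "'a measure \<Rightarrow> (int \<times> int \<Rightarrow> 'a \<Rightarrow> 'a) \<Rightarrow> bool" where
  "weakly_mixing M T \<longleftrightarrow> trivial_mod_null M (kronecker_algebra M T)"

end

theory Submission
  imports Defs
begin

text \<open>Only the two rational directions \<open>(1, 0)\<close> and \<open>(1, 1)\<close> are needed: every strip around them
  contains a lattice line, whatever its width, and the two lines together generate \<open>\<int>\<^sup>2\<close>. Since the
  Koopman operators are commuting isometries, an orbit that is totally bounded along each of two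
  subsets of \<open>\<int>\<^sup>2\<close> is totally bounded along their sumset, and completeness of \<open>L\<^sup>2\<close> turns total
  boundedness into compactness of the closure. So a set in both directional algebras lies in the
  Kronecker algebra. The other implication is monotonicity: the Kronecker algebra is contained in
  every directional one.\<close>

section \<open>Completeness of \<open>L\<^sup>2\<close>\<close>

lemma L2_space_representative:
  assumes "F \<in> L2_space M"
  obtains f where "f \<in> L2_functions M" "F = L2_class M f"
  using assms by (auto simp: L2_space_def L2_class_def elim!: quotientE)

lemma L2_functions_diff_closed:
  assumes "f \<in> L2_functions M" "g \<in> L2_functions M"
  shows "(\<lambda>x. f x - g x) \<in> L2_functions M"
  using assms L2_functions_diff[OF assms] by (auto simp: L2_functions_def)

lemma (in prob_space) L2_functions_integrable:
  assumes "f \<in> L2_functions M"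
  shows "integrable M f"
proof -
  have [measurable]: "f \<in> borel_measurable M" and "integrable M (\<lambda>x. (cmod (f x))\<^sup>2)"
    using assms by (auto simp: L2_functions_def)
  from this(2) have "integrable M (\<lambda>x. cmod (f x))"
    by (rule square_integrable_imp_integrable[rotated]) measurable
  then show ?thesis
    by (rule integrable_norm_cancel) measurable
qed

text \<open>The variance of \<open>cmod (f x - g x)\<close> is nonnegative, so on a probability
  space the L1 distance is dominated by the L2 distance. An L2-Cauchy sequence is thereby L1-Cauchy,
  which yields an a.e. convergent subsequence.\<close>

lemma (in prob_space) expectation_cmod_diff_le_L2_dist_fun:
  assumes "f \<in> L2_functions M" "g \<in> L2_functions M"
  shows "expectation (\<lambda>x. cmod (f x - g x)) \<le> L2_dist_fun M f g"
proof -
  have "integrable M (\<lambda>x. cmod (f x - g x))"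
    using L2_functions_integrable[OF L2_functions_diff_closed[OF assms]] by simp
  then have "(expectation (\<lambda>x. cmod (f x - g x)))\<^sup>2 \<le> expectation (\<lambda>x. (cmod (f x - g x))\<^sup>2)"
    using variance_positive[of "\<lambda>x. cmod (f x - g x)"] L2_functions_diff[OF assms]
    by (simp add: variance_eq)
  then show ?thesis
    unfolding L2_dist_fun_def by (rule real_le_rsqrt)
qed

text \<open>Fatou's lemma for the squared distances between \<open>g\<close> and \<open>s k\<close>.
  It carries a uniform L2 bound over to the a.e. limit and gives square integrability of the limit
  at the same time.\<close>

lemma L2_dist_fun_Fatou:
  fixes s :: "nat \<Rightarrow> 'a \<Rightarrow> complex"
  assumes g: "g \<in> L2_functions M" and s: "\<And>k. s k \<in> L2_functions M"
    and f [measurable]: "f \<in> borel_measurable M"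
    and lim: "AE x in M. (\<lambda>k. s k x) \<longlonglongrightarrow> f x"
    and le: "\<And>k. k \<ge> N \<Longrightarrow> L2_dist_fun M g (s k) \<le> e"
  shows "f \<in> L2_functions M" and "L2_dist_fun M g f \<le> e"
proof -
  have [measurable]: "g \<in> borel_measurable M" "\<And>k. s k \<in> borel_measurable M"
    using g s by (auto simp: L2_functions_def)
  \<comment> \<open>The sign of \<open>e\<close> is needed at the end, to return from the bound on
    squares to a bound by \<open>e\<close> itself.\<close>
  have "0 \<le> L2_dist_fun M g (s N)"
    by (simp add: L2_dist_fun_def)
  with le[of N] have "e \<ge> 0" by simp
  have "(\<integral>\<^sup>+x. ennreal ((cmod (g x - f x))\<^sup>2) \<partial>M)
      = (\<integral>\<^sup>+x. liminf (\<lambda>k. ennreal ((cmod (g x - s k x))\<^sup>2)) \<partial>M)"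
  proof (rule nn_integral_cong_AE)
    show "AE x in M. ennreal ((cmod (g x - f x))\<^sup>2) = liminf (\<lambda>k. ennreal ((cmod (g x - s k x))\<^sup>2))"
      using lim
    proof eventually_elim
      case (elim x)
      then have "(\<lambda>k. ennreal ((cmod (g x - s k x))\<^sup>2)) \<longlonglongrightarrow> ennreal ((cmod (g x - f x))\<^sup>2)"
        by (intro tendsto_intros)
      then show ?case
        by (rule lim_imp_Liminf[OF sequentially_bot, symmetric])
    qed
  qed
  also have "\<dots> \<le> liminf (\<lambda>k. \<integral>\<^sup>+x. ennreal ((cmod (g x - s k x))\<^sup>2) \<partial>M)"
    by (rule nn_integral_liminf) measurable
  also have "\<dots> \<le> ennreal (e\<^sup>2)"
  proof (rule Liminf_le)
    have "(\<integral>\<^sup>+x. ennreal ((cmod (g x - s k x))\<^sup>2) \<partial>M) \<le> ennreal (e\<^sup>2)" if "k \<ge> N" for k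
      using le[OF that] L2_functions_diff[OF g s[of k]]
      by (auto simp: nn_integral_eq_integral L2_dist_fun_def intro!: ennreal_leI sqrt_le_D)
    then show "\<forall>\<^sub>F k in sequentially. (\<integral>\<^sup>+x. ennreal ((cmod (g x - s k x))\<^sup>2) \<partial>M) \<le> ennreal (e\<^sup>2)"
      by (auto simp: eventually_sequentially)
  qed simp
  finally have bound: "(\<integral>\<^sup>+x. ennreal ((cmod (g x - f x))\<^sup>2) \<partial>M) \<le> ennreal (e\<^sup>2)" .
  have int: "integrable M (\<lambda>x. (cmod (g x - f x))\<^sup>2)"
    using bound by (intro integrableI_nonneg) (auto simp: order_le_less_trans)
  then have "(\<lambda>x. g x - f x) \<in> L2_functions M"
    by (simp add: L2_functions_def)
  \<comment> \<open>Here \<open>f\<close> is recovered as \<open>g - (g - f)\<close>, a difference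
    of two square integrable functions.\<close>
  from L2_functions_diff_closed[OF g this] show "f \<in> L2_functions M"
    by simp
  from bound have "(\<integral>x. (cmod (g x - f x))\<^sup>2 \<partial>M) \<le> e\<^sup>2"
    using int by (simp add: nn_integral_eq_integral)
  then show "L2_dist_fun M g f \<le> e"
    using \<open>e \<ge> 0\<close> unfolding L2_dist_fun_def by (intro real_le_lsqrt) auto
qed

text \<open>Riesz-Fischer: a subsequence converges a.e., and Fatou along it shows that the whole
  Cauchy sequence tends to the pointwise limit in L2.\<close>

lemma (in prob_space) mcomplete_L2: "Metric_space.mcomplete (L2_space M) (L2_dist M)"
proof -
  interpret L2: Metric_space "L2_space M" "L2_dist M"
    by (rule Metric_space_L2)
  show ?thesis
    unfolding L2.mcomplete_def
  proof (intro allI impI)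
    fix \<sigma> assume \<sigma>: "L2.MCauchy \<sigma>"
    then have "\<sigma> n \<in> L2_space M" for n
      by (auto simp: L2.MCauchy_def)
    then have "\<exists>s\<in>L2_functions M. \<sigma> n = L2_class M s" for n
      by (meson L2_space_representative)
    then obtain s where s: "\<And>n. s n \<in> L2_functions M" and \<sigma>_eq: "\<And>n. \<sigma> n = L2_class M (s n)"
      by metis
    have cau: "\<exists>N. \<forall>i\<ge>N. \<forall>j\<ge>N. L2_dist_fun M (s i) (s j) < e" if e: "e > 0" for e
    proof -
      have "\<forall>e>0. \<exists>N. \<forall>i j. N \<le> i \<longrightarrow> N \<le> j \<longrightarrow> L2_dist M (\<sigma> i) (\<sigma> j) < e"
        using \<sigma> by (simp add: L2.MCauchy_def)
      with e show ?thesis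
        by (simp add: \<sigma>_eq L2_dist_class s)
    qed
    have "\<exists>N. \<forall>i\<ge>N. \<forall>j\<ge>N. expectation (\<lambda>x. cmod (s i x - s j x)) < e" if e: "e > 0" for e
    proof -
      obtain N where "\<forall>i\<ge>N. \<forall>j\<ge>N. L2_dist_fun M (s i) (s j) < e"
        using cau[OF e] by blast
      then have "\<forall>i\<ge>N. \<forall>j\<ge>N. expectation (\<lambda>x. cmod (s i x - s j x)) < e"
        by (blast intro: order_le_less_trans[OF expectation_cmod_diff_le_L2_dist_fun[OF s s]])
      then show ?thesis ..
    qed
    from L2_functions_integrable[OF s] this
    obtain r where r: "strict_mono r" "AE x in M. Cauchy (\<lambda>i. s (r i) x)"
      by (rule cauchy_L1_AE_cauchy_subseq)
    have [measurable]: "s n \<in> borel_measurable M" for n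
      using s by (simp add: L2_functions_def)
    \<comment> \<open>On the null set where the subsequence diverges, \<open>lim\<close> returns a
      fixed default value, so \<open>f\<close> is still measurable on the whole space.\<close>
    define f where "f = (\<lambda>x. lim (\<lambda>i. s (r i) x))"
    have f_meas: "f \<in> borel_measurable M"
      unfolding f_def by measurable
    have f_lim: "AE x in M. (\<lambda>i. s (r i) x) \<longlonglongrightarrow> f x"
      using r(2) by eventually_elim (simp add: f_def Cauchy_convergent_iff convergent_LIMSEQ_iff)
    have close: "\<exists>N. \<forall>n\<ge>N. f \<in> L2_functions M \<and> L2_dist_fun M (s n) f \<le> e" if e: "e > 0" for e
    proof -
      obtain N where N: "\<And>i j. i \<ge> N \<Longrightarrow> j \<ge> N \<Longrightarrow> L2_dist_fun M (s i) (s j) < e"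
        using cau[OF e] by blast
      have "f \<in> L2_functions M \<and> L2_dist_fun M (s n) f \<le> e" if n: "n \<ge> N" for n
      proof -
        \<comment> \<open>Strict monotonicity gives \<open>k \<le> r k\<close>, so the Cauchy
          estimate applies to \<open>s n\<close> and every late term of the subsequence.\<close>
        have "L2_dist_fun M (s n) (s (r k)) \<le> e" if "k \<ge> N" for k
          using N[OF n, of "r k"] seq_suble[OF r(1), of k] that by simp
        from L2_dist_fun_Fatou[OF s s f_meas f_lim this] show ?thesis
          by blast
      qed
      then show ?thesis by blast
    qed
    have f: "f \<in> L2_functions M"
      using close[of 1] by auto
    have "limitin L2.mtopology \<sigma> (L2_class M f) sequentially"
      unfolding L2.limit_metric_sequentially
    proof (intro conjI allI impI)
      fix e :: real assume "e > 0"
      \<comment> \<open>Fatou only yields a non-strict bound; halving \<open>e\<close> makes it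
        strict.\<close>
      then obtain N where "\<forall>n\<ge>N. L2_dist_fun M (s n) f \<le> e / 2"
        using close[of "e / 2"] by auto
      with \<open>e > 0\<close> show "\<exists>N. \<forall>n\<ge>N. \<sigma> n \<in> L2_space M \<and> L2_dist M (\<sigma> n) (L2_class M f) < e"
        by (intro exI[of _ N]) (fastforce simp: \<sigma>_eq L2_dist_class s f L2_class_in_space)
    qed (rule L2_class_in_space[OF f])
    then show "\<exists>F. limitin L2.mtopology \<sigma> F sequentially" ..
  qed
qed


section \<open>Orbits of the Koopman representation\<close>

text \<open>A smaller index set has a smaller orbit closure, and a closed subset of a compact set is
  compact.\<close>

lemma compact_orbit_sets_antimono:
  assumes "A \<subseteq> B"
  shows "compact_orbit_sets M T B \<subseteq> compact_orbit_sets M T A"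
proof
  fix E assume E: "E \<in> compact_orbit_sets M T B"
  have "L2_topology M closure_of L2_orbit M T A E \<subseteq> L2_topology M closure_of L2_orbit M T B E"
    using assms by (intro closure_of_mono) (auto simp: L2_orbit_def)
  with E show "E \<in> compact_orbit_sets M T A"
    unfolding compact_orbit_sets_def by (auto intro: closed_compactin)
qed

context Z2_measure_preserving_system
begin

section \<open>Koopman operators as commuting isometries\<close>

lemma measurable_T [measurable]: "T k \<in> measurable M M"
proof -
  have "continuous_on UNIV (T k)"
    using homeomorphism_T[of k] by (auto simp: homeomorphism_def)
  then have "T k \<in> borel_measurable borel"
    by (rule borel_measurable_continuous_onI)
  then show ?thesis
    using measurable_cong_sets[OF sets_eq_borel sets_eq_borel] by blast
qed

lemma koopman_add: "koopman T (k + l) f = koopman T l (koopman T k f)"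
  by (simp add: koopman_def T_add comp_assoc)

lemma koopman_in_L2_functions:
  assumes "f \<in> L2_functions M"
  shows "koopman T k f \<in> L2_functions M"
proof -
  have [measurable]: "f \<in> borel_measurable M" and "integrable M (\<lambda>x. (cmod (f x))\<^sup>2)"
    using assms by (auto simp: L2_functions_def)
  then have "integrable (distr M M (T k)) (\<lambda>x. (cmod (f x))\<^sup>2)"
    by (simp add: invariant)
  then have "integrable M (\<lambda>x. (cmod (f (T k x)))\<^sup>2)"
    by (rule integrable_distr[rotated]) measurable
  then show ?thesis
    by (simp add: L2_functions_def koopman_def comp_def)
qed

lemma L2_dist_fun_koopman:
  assumes "f \<in> L2_functions M" "g \<in> L2_functions M"
  shows "L2_dist_fun M (koopman T k f) (koopman T k g) = L2_dist_fun M f g"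
proof -
  have [measurable]: "f \<in> borel_measurable M" "g \<in> borel_measurable M"
    using assms by (auto simp: L2_functions_def)
  have "(\<integral>x. (cmod (f x - g x))\<^sup>2 \<partial>M) = (\<integral>x. (cmod (f x - g x))\<^sup>2 \<partial>distr M M (T k))"
    by (simp add: invariant)
  also have "\<dots> = (\<integral>x. (cmod (f (T k x) - g (T k x)))\<^sup>2 \<partial>M)"
    by (rule integral_distr) measurable
  finally show ?thesis
    by (simp add: L2_dist_fun_def koopman_def)
qed

text \<open>Pass from \<open>a + b\<close> to \<open>c + d\<close> through \<open>c + b\<close>:
  each of the two moves changes one summand, and the operator of the common summand is an isometry
  that cancels.\<close>

lemma L2_dist_fun_koopman_add_le:
  assumes f: "f \<in> L2_functions M"
  shows "L2_dist_fun M (koopman T (a + b) f) (koopman T (c + d) f)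
    \<le> L2_dist_fun M (koopman T a f) (koopman T c f) + L2_dist_fun M (koopman T b f) (koopman T d f)"
proof -
  note L2 = koopman_in_L2_functions
  have "L2_dist_fun M (koopman T (a + b) f) (koopman T (c + d) f)
      \<le> L2_dist_fun M (koopman T (a + b) f) (koopman T (c + b) f)
        + L2_dist_fun M (koopman T (c + b) f) (koopman T (c + d) f)"
    by (intro L2_dist_fun_triangle L2 f)
  also have "L2_dist_fun M (koopman T (a + b) f) (koopman T (c + b) f)
      = L2_dist_fun M (koopman T a f) (koopman T c f)"
    by (simp add: koopman_add L2_dist_fun_koopman L2 f)
  \<comment> \<open>\<open>koopman_add\<close> puts the operator of the first summand innermost, so
    commutativity of the group is used to bring that of \<open>c\<close> to the outside.\<close>
  also have "L2_dist_fun M (koopman T (c + b) f) (koopman T (c + d) f)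
      = L2_dist_fun M (koopman T b f) (koopman T d f)"
    by (simp add: add.commute[of c] koopman_add L2_dist_fun_koopman L2 f)
  finally show ?thesis .
qed

section \<open>Total boundedness of orbits\<close>

lemma mtotally_bounded_orbit_iff:
  assumes f: "f \<in> L2_functions M"
  shows "Metric_space.mtotally_bounded (L2_space M) (L2_dist M) ((\<lambda>k. L2_class M (koopman T k f)) ` A)
    \<longleftrightarrow> (\<forall>e>0. \<exists>C. finite C \<and> C \<subseteq> A \<and>
          (\<forall>a\<in>A. \<exists>c\<in>C. L2_dist_fun M (koopman T c f) (koopman T a f) < e))"
    (is "Metric_space.mtotally_bounded _ _ (?u ` A) \<longleftrightarrow> _")
proof -
  interpret L2: Metric_space "L2_space M" "L2_dist M"
    by (rule Metric_space_L2)
  have cover: "?u ` A \<subseteq> (\<Union>x\<in>?u ` C. L2.mball x e) \<longleftrightarrow>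
      (\<forall>a\<in>A. \<exists>c\<in>C. L2_dist_fun M (koopman T c f) (koopman T a f) < e)" for C e
    by (auto simp: image_subset_iff L2_dist_class koopman_in_L2_functions f L2_class_in_space)
  \<comment> \<open>The centres of a finite net lie in the orbit, so they can be indexed by finitely
    many group elements, which, unlike L2 classes, can be added in the group.\<close>
  have "(\<exists>K. finite K \<and> K \<subseteq> ?u ` A \<and> ?u ` A \<subseteq> (\<Union>x\<in>K. L2.mball x e)) \<longleftrightarrow>
      (\<exists>C. finite C \<and> C \<subseteq> A \<and> ?u ` A \<subseteq> (\<Union>x\<in>?u ` C. L2.mball x e))" for e
    by (rule ex_finite_subset_image)
  then show ?thesis
    unfolding L2.mtotally_bounded_def cover by simp
qed

text \<open>If \<open>C\<close> and \<open>D\<close> index finite \<open>e / 2\<close>-nets of the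
  two orbits, the sums of their elements index a finite \<open>e\<close>-net of the orbit along the
  sumset.\<close>

lemma mtotally_bounded_orbit_sumset:
  assumes f: "f \<in> L2_functions M"
    and A: "Metric_space.mtotally_bounded (L2_space M) (L2_dist M) ((\<lambda>k. L2_class M (koopman T k f)) ` A)"
    and B: "Metric_space.mtotally_bounded (L2_space M) (L2_dist M) ((\<lambda>k. L2_class M (koopman T k f)) ` B)"
  shows "Metric_space.mtotally_bounded (L2_space M) (L2_dist M)
    ((\<lambda>k. L2_class M (koopman T k f)) ` (\<lambda>(a, b). a + b) ` (A \<times> B))"
  unfolding mtotally_bounded_orbit_iff[OF f]
proof (intro allI impI)
  fix e :: real assume "e > 0"
  obtain C where C: "finite C" "C \<subseteq> A"
      "\<And>a. a \<in> A \<Longrightarrow> \<exists>c\<in>C. L2_dist_fun M (koopman T c f) (koopman T a f) < e / 2"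
    using A[unfolded mtotally_bounded_orbit_iff[OF f]] \<open>e > 0\<close> half_gt_zero by meson
  obtain D where D: "finite D" "D \<subseteq> B"
      "\<And>b. b \<in> B \<Longrightarrow> \<exists>d\<in>D. L2_dist_fun M (koopman T d f) (koopman T b f) < e / 2"
    using B[unfolded mtotally_bounded_orbit_iff[OF f]] \<open>e > 0\<close> half_gt_zero by meson
  have "\<exists>k\<in>(\<lambda>(a, b). a + b) ` (C \<times> D). L2_dist_fun M (koopman T k f) (koopman T (a + b) f) < e"
    if ab: "a \<in> A" "b \<in> B" for a b
  proof -
    obtain c d where cd: "c \<in> C" "d \<in> D"
        "L2_dist_fun M (koopman T c f) (koopman T a f) < e / 2"
        "L2_dist_fun M (koopman T d f) (koopman T b f) < e / 2"
      using C(3)[OF ab(1)] D(3)[OF ab(2)] by blast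
    then have "L2_dist_fun M (koopman T (c + d) f) (koopman T (a + b) f) < e"
      using L2_dist_fun_koopman_add_le[OF f, of c d a b] by simp
    with cd(1,2) show ?thesis by force
  qed
  moreover have "(\<lambda>(a, b). a + b) ` (C \<times> D) \<subseteq> (\<lambda>(a, b). a + b) ` (A \<times> B)"
    using C(2) D(2) by (intro image_mono Sigma_mono)
  ultimately show "\<exists>K. finite K \<and> K \<subseteq> (\<lambda>(a, b). a + b) ` (A \<times> B) \<and>
      (\<forall>k\<in>(\<lambda>(a, b). a + b) ` (A \<times> B). \<exists>l\<in>K. L2_dist_fun M (koopman T l f) (koopman T k f) < e)"
    using C(1) D(1) by (intro exI[of _ "(\<lambda>(a, b). a + b) ` (C \<times> D)"]) auto
qed

lemma indicator_in_L2_functions: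
  assumes "E \<in> sets M"
  shows "indicator E \<in> L2_functions M"
proof -
  have "(\<lambda>x. (cmod (indicator E x))\<^sup>2) = (indicator E :: 'a \<Rightarrow> real)"
    by (auto simp: indicator_def)
  moreover have "integrable M (indicator E :: 'a \<Rightarrow> real)"
    using assms by (simp add: integrable_indicator_iff less_top[symmetric])
  ultimately show ?thesis
    using assms by (simp add: L2_functions_def)
qed

text \<open>In a complete metric space a subset has compact closure exactly when it is totally
  bounded; this is where \<open>mcomplete_L2\<close> enters.\<close>

lemma compact_orbit_sets_iff_mtotally_bounded:
  "E \<in> compact_orbit_sets M T A \<longleftrightarrow>
    E \<in> sets M \<and> Metric_space.mtotally_bounded (L2_space M) (L2_dist M) (L2_orbit M T A E)"
proof -
  interpret L2: Metric_space "L2_space M" "L2_dist M"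
    by (rule Metric_space_L2)
  have "L2_orbit M T A E \<subseteq> L2_space M" if "E \<in> sets M"
    using that by (auto simp: L2_orbit_def
      intro!: L2_class_in_space koopman_in_L2_functions indicator_in_L2_functions)
  then show ?thesis
    by (auto simp: compact_orbit_sets_def L2_topology_def
      L2.mtotally_bounded_eq_compact_closure_of[OF mcomplete_L2])
qed

lemma compact_orbit_sets_Int_subset_sumset:
  "compact_orbit_sets M T A \<inter> compact_orbit_sets M T B
    \<subseteq> compact_orbit_sets M T ((\<lambda>(a, b). a + b) ` (A \<times> B))"
  using mtotally_bounded_orbit_sumset[OF indicator_in_L2_functions]
  by (auto simp: compact_orbit_sets_iff_mtotally_bounded L2_orbit_def)

section \<open>Comparison of the Kronecker algebras\<close>

lemma kronecker_algebra_subset_directional: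
  "kronecker_algebra M T \<subseteq> directional_kronecker_algebra M T \<beta> b"
  unfolding kronecker_algebra_def directional_kronecker_algebra_def
  by (rule compact_orbit_sets_antimono) simp

lemma directional_Int_subset_kronecker_algebra:
  assumes "b1 \<ge> 0" "b2 \<ge> 0"
  shows "directional_kronecker_algebra M T 0 b1 \<inter> directional_kronecker_algebra M T 1 b2
    \<subseteq> kronecker_algebra M T"
proof -
  \<comment> \<open>Write \<open>(m, n) = (m - n, 0) + (n, n)\<close>: the summands lie on the lines
    of slope 0 and 1, hence in the strips of any nonnegative width.\<close>
  have "(m, n) \<in> (\<lambda>(a, b). a + b) ` (strip 0 b1 \<times> strip 1 b2)" for m n
    using assms by (intro image_eqI[of _ _ "((m - n, 0), (n, n))"]) (auto simp: strip_def)
  then have "(\<lambda>(a, b). a + b) ` (strip 0 b1 \<times> strip 1 b2) = UNIV"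
    by auto
  then show ?thesis
    using compact_orbit_sets_Int_subset_sumset[of "strip 0 b1" "strip 1 b2"]
    by (simp add: directional_kronecker_algebra_def kronecker_algebra_def)
qed

end

theorem theorem5p5:
  fixes M :: "'a::metric_space measure"
    and T :: "int \<times> int \<Rightarrow> 'a \<Rightarrow> 'a"
    and b1 b2 :: real
  assumes "Z2_measure_preserving_system M T"
    and "b1 > 0" and "b2 > 0"
  shows "(\<exists>\<beta>1 \<beta>2. \<beta>1 \<noteq> \<beta>2 \<and>
            trivial_mod_null M
              (directional_kronecker_algebra M T \<beta>1 b1 \<inter> directional_kronecker_algebra M T \<beta>2 b2))
         \<longleftrightarrow> weakly_mixing M T"
proof -
  interpret Z2_measure_preserving_system M T
    by (rule assms(1))
  show ?thesis
  proof
    assume "\<exists>\<beta>1 \<beta>2. \<beta>1 \<noteq> \<beta>2 \<and> trivial_mod_null M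
      (directional_kronecker_algebra M T \<beta>1 b1 \<inter> directional_kronecker_algebra M T \<beta>2 b2)"
    then show "weakly_mixing M T"
      using kronecker_algebra_subset_directional
      unfolding weakly_mixing_def trivial_mod_null_def by blast
  next
    assume "weakly_mixing M T"
    then have "trivial_mod_null M
        (directional_kronecker_algebra M T 0 b1 \<inter> directional_kronecker_algebra M T 1 b2)"
      using directional_Int_subset_kronecker_algebra[of b1 b2] assms(2,3)
      unfolding weakly_mixing_def trivial_mod_null_def by auto
    then show "\<exists>\<beta>1 \<beta>2. \<beta>1 \<noteq> \<beta>2 \<and> trivial_mod_null M
        (directional_kronecker_algebra M T \<beta>1 b1 \<inter> directional_kronecker_algebra M T \<beta>2 b2)"
      using zero_neq_one by blast
  qed
qed

end
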